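(* Let $X_s=B_s+\sum_{i=1}^{N_s}\eta_i$ be a Brownian motion with random jumps as described in the context, fix $t>0$, and let $b:[0,t]\to\mathbb R$ be a function. For each $n\ge1$ let $0=s_0<s_1<\cdots<s_n=t$ be a partition of $[0,t]$ (depending on $n$) and let $b_n$ be the piecewise linear function connecting the points $(s_i,b(s_i))$, $i=0,1,\ldots,n$. Suppose that $\max_{0\le s\le t}|b_n(s)-b(s)|\to0$ as $n\to\infty$. Then $$\lim_{n\to\infty}P\Big(\max_{0\le s<t}\{X_s-b_n(s)\}<0\Big)=P\Big(\max_{0\le s<t}\{X_s-b(s)\}<0\Big).$$
   Context: $(B_s)_{s\ge0}$ is a standard Brownian motion with $B_0=0$; $(N_s)_{s\ge0}$ is an integer-valued jump process with $N_0=0$ counting the jumps (right-continuous, nondecreasing, increasing by unit steps, finitely many jumps in bounded intervals), not necessarily Poisson; $(\eta_i)_{i\ge1}$ are real random variables (jump sizes), not necessarily independent or identically distributed. The three objects $(B_s)$, $(N_s)$, $(\eta_i)$ are mutually independent. "Max" is understood as supremum. *)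

theory Defs
  imports "HOL-Probability.Probability"
begin

text \<open>Path properties are required for every sample point, as usual for processes with continuous
  or right-continuous paths; this makes the suprema over time measurable without assuming that the
  probability space is complete.\<close>

definition standard_brownian_motion :: "'w measure \<Rightarrow> (real \<Rightarrow> 'w \<Rightarrow> real) \<Rightarrow> bool" where
  "standard_brownian_motion M B \<longleftrightarrow>
     (\<forall>s\<ge>0. B s \<in> borel_measurable M) \<and>
     (\<forall>\<omega>\<in>space M. B 0 \<omega> = 0) \<and>
     (\<forall>\<omega>\<in>space M. continuous_on {0..} (\<lambda>s. B s \<omega>)) \<and>
     (\<forall>s u. 0 \<le> s \<and> s < u \<longrightarrow>
        distributed M lborel (\<lambda>\<omega>. B u \<omega> - B s \<omega>) (normal_density 0 (sqrt (u - s)))) \<and>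
     (\<forall>k (r :: nat \<Rightarrow> real). 0 \<le> r 0 \<and> (\<forall>i<k. r i < r (Suc i)) \<longrightarrow>
        prob_space.indep_vars M (\<lambda>_. borel) (\<lambda>i \<omega>. B (r (Suc i)) \<omega> - B (r i) \<omega>) {..<k})"

text \<open>The limits of \<open>N\<close> below are taken in the discrete topology of \<open>nat\<close>. Finiteness of the set of
  jump times already follows from monotonicity, and is listed only because it is part of the usual
  description.\<close>

definition jump_counting_process :: "'w measure \<Rightarrow> (real \<Rightarrow> 'w \<Rightarrow> nat) \<Rightarrow> bool" where
  "jump_counting_process M N \<longleftrightarrow>
     (\<forall>s\<ge>0. N s \<in> measurable M (count_space UNIV)) \<and>
     (\<forall>\<omega>\<in>space M.
        N 0 \<omega> = 0 \<and>
        mono_on {0..} (\<lambda>s. N s \<omega>) \<and>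
        (\<forall>s\<ge>0. ((\<lambda>u. N u \<omega>) \<longlongrightarrow> N s \<omega>) (at_right s)) \<and>
        (\<forall>s>0. \<exists>k. ((\<lambda>u. N u \<omega>) \<longlongrightarrow> k) (at_left s) \<and> (N s \<omega> = k \<or> N s \<omega> = Suc k)) \<and>
        (\<forall>T. finite {s\<in>{0<..T}. \<not> isCont (\<lambda>u. N u \<omega>) s}))"

definition generated_events ::
    "'w measure \<Rightarrow> 'i set \<Rightarrow> 'a measure \<Rightarrow> ('i \<Rightarrow> 'w \<Rightarrow> 'a) \<Rightarrow> 'w set set" where
  "generated_events M I S Y =
     sigma_sets (space M) {Y i -` A \<inter> space M | i A. i \<in> I \<and> A \<in> sets S}"

definition mutually_independent ::
    "'w measure \<Rightarrow> (real \<Rightarrow> 'w \<Rightarrow> real) \<Rightarrow> (real \<Rightarrow> 'w \<Rightarrow> nat) \<Rightarrow> (nat \<Rightarrow> 'w \<Rightarrow> real) \<Rightarrow> bool" where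
  "mutually_independent M B N \<eta> \<longleftrightarrow>
     prob_space.indep_sets M
       (\<lambda>j::nat. [generated_events M {0..} borel B,
                  generated_events M {0..} (count_space UNIV) N,
                  generated_events M {1..} borel \<eta>] ! j)
       {..<3}"

definition brownian_with_jumps ::
    "(real \<Rightarrow> 'w \<Rightarrow> real) \<Rightarrow> (real \<Rightarrow> 'w \<Rightarrow> nat) \<Rightarrow> (nat \<Rightarrow> 'w \<Rightarrow> real) \<Rightarrow> real \<Rightarrow> 'w \<Rightarrow> real" where
  "brownian_with_jumps B N \<eta> s \<omega> = B s \<omega> + (\<Sum>i=1..N s \<omega>. \<eta> i \<omega>)"

definition is_partition :: "real \<Rightarrow> nat \<Rightarrow> (nat \<Rightarrow> real) \<Rightarrow> bool" where
  "is_partition t n p \<longleftrightarrow> p 0 = 0 \<and> p n = t \<and> (\<forall>i<n. p i < p (Suc i))"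

text \<open>The piecewise linear function through the points \<open>(p i, f (p i))\<close> for \<open>i \<le> n\<close>; only its values
  on \<open>[p 0, p n]\<close> are meaningful.\<close>

definition piecewise_linear :: "nat \<Rightarrow> (nat \<Rightarrow> real) \<Rightarrow> (real \<Rightarrow> real) \<Rightarrow> real \<Rightarrow> real" where
  "piecewise_linear n p f x =
     (let i = Max {i. i < n \<and> p i \<le> x}
      in f (p i) + (f (p (Suc i)) - f (p i)) / (p (Suc i) - p i) * (x - p i))"

lemma piecewise_linear_on_segment:
  assumes p: "is_partition t n p" and i: "i < n" and x: "x \<in> {p i..p (Suc i)}"
  shows "piecewise_linear n p f x
           = f (p i) + (f (p (Suc i)) - f (p i)) / (p (Suc i) - p i) * (x - p i)"
proof -
  have step: "p j < p (Suc j)" if "j < n" for j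
    using p that by (simp add: is_partition_def)
  have less: "p j < p k" if "j < k" "k \<le> n" for j k
    using that
  proof (induction k)
    case (Suc k)
    then show ?case using step[of k] by (cases "j = k") auto
  qed simp
  have fin: "finite {j. j < n \<and> p j \<le> x}" by simp
  show ?thesis
  proof (cases "x = p (Suc i) \<and> Suc i < n")
    case True
    have "Max {j. j < n \<and> p j \<le> x} = Suc i"
    proof (rule Max_eqI[OF fin])
      fix j assume "j \<in> {j. j < n \<and> p j \<le> x}"
      then show "j \<le> Suc i" using less[of "Suc i" j] True by fastforce
    qed (use True in auto)
    then show ?thesis using True step[OF i] by (simp add: piecewise_linear_def Let_def)
  next
    case False
    have "Max {j. j < n \<and> p j \<le> x} = i"
    proof (rule Max_eqI[OF fin])
      fix j assume j: "j \<in> {j. j < n \<and> p j \<le> x}"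
      show "j \<le> i"
      proof (rule ccontr)
        assume "\<not> j \<le> i"
        then have "p (Suc i) \<le> p j" using less[of "Suc i" j] j by (cases "j = Suc i") auto
        with j x have "x = p (Suc i)" by auto
        with False j \<open>\<not> j \<le> i\<close> show False by auto
      qed
    qed (use i x in auto)
    then show ?thesis by (simp add: piecewise_linear_def Let_def)
  qed
qed

end

theory Submission
  imports Defs
begin

text \<open>As a uniform limit of continuous functions \<open>b\<close> is continuous, so the suprema converge pointwise
  and only the event that the limiting supremum vanishes has to be shown null. If \<open>b 0 \<le> 0\<close>, this may
  fail, but \<open>s = 0\<close> is a node of every partition, so all events considered are empty. If \<open>b 0 > 0\<close>,
  right-continuity at \<open>0\<close> shows that the supremum can only vanish if the supremum over \<open>[a, t)\<close> does,
  for some small \<open>a\<close>. The latter is \<open>B a\<close> plus a quantity that depends only on the increments of \<open>B\<close>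
  after time \<open>a\<close>, on the jump times and on the jump sizes, hence is independent of \<open>B a\<close>, whose
  density is bounded. Replacing \<open>[a, t)\<close> by finite grids makes independence a statement about finitely
  many increments.\<close>

section \<open>Independence of split components and bounded densities\<close>

context prob_space
begin

text \<open>For \<open>a \<in> A\<close> and \<open>d \<in> D\<close> the intersection lies in
  \<open>G1\<close>, so the three-fold product rule followed by the independence of \<open>A\<close>
  and \<open>D\<close> gives a four-fold product rule for \<open>A\<close>, \<open>D\<close>,
  \<open>G2\<close>, \<open>G3\<close>. Families closed under intersection may then be grouped into
  generated sigma-algebras. In the application \<open>A\<close> comes from the first Brownian
  increment and \<open>D\<close> from the later ones.\<close>

lemma indep_set_of_split_component:
  assumes ind: "indep_sets (\<lambda>j::nat. [G1, G2, G3] ! j) {..<3}"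
    and AD: "indep_set A D" "A \<subseteq> G1" "D \<subseteq> G1"
    and alg: "algebra (space M) G1"
    and stable: "Int_stable A" "Int_stable D" "Int_stable G2" "Int_stable G3"
    and top: "space M \<in> A" "space M \<in> D" "space M \<in> G2" "space M \<in> G3"
  shows "indep_set (sigma_sets (space M) A) (sigma_sets (space M) (D \<union> G2 \<union> G3))"
proof -
  have three: "{..<3::nat} = {0, 1, 2}" and four: "{..<4::nat} = {0, 1, 2, 3}" by auto
  interpret G1: algebra "space M" G1 by (fact alg)
  have ev: "G1 \<subseteq> events" "G2 \<subseteq> events" "G3 \<subseteq> events"
    using ind by (auto simp: indep_sets_def three)
  have prod3: "prob (a \<inter> b \<inter> c) = prob a * prob b * prob c"
    if "a \<in> G1" "b \<in> G2" "c \<in> G3" for a b c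
    using indep_setsD[OF ind, of "{0, 1, 2}" "\<lambda>j. [a, b, c] ! j"] that
    by (simp add: three Int_assoc mult.assoc)
  have prod2: "prob (a \<inter> d) = prob a * prob d" if "a \<in> A" "d \<in> D" for a d
    using AD(1) that by (simp add: indep_setD)
  let ?F = "\<lambda>j::nat. [A, D, G2, G3] ! j"
  have "indep_sets ?F {..<4}"
  \<comment> \<open>Each family contains \<open>space M\<close>, so the product rule over all four
    indices already covers every smaller selection.\<close>
  proof (subst indep_sets_finite)
    show "\<forall>E\<in>Pi {..<4} ?F. prob (\<Inter>j\<in>{..<4}. E j) = (\<Prod>j\<in>{..<4}. prob (E j))"
    proof
      fix E assume "E \<in> Pi {..<4} ?F"
      then have E: "E 0 \<in> A" "E 1 \<in> D" "E 2 \<in> G2" "E 3 \<in> G3"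
        by (auto simp: Pi_iff four numeral_2_eq_2 numeral_3_eq_3)
      have "E 0 \<inter> E 1 \<in> G1" using E AD by auto
      from prod3[OF this E(3,4)] prod2[OF E(1,2)]
      show "prob (\<Inter>j\<in>{..<4}. E j) = (\<Prod>j\<in>{..<4}. prob (E j))"
        by (simp add: four Int_assoc mult.assoc)
    qed
  qed (use ev AD top in \<open>auto simp: four numeral_2_eq_2 numeral_3_eq_3\<close>)
  \<comment> \<open>The two blocks are indexed by truth values because \<open>indep_set\<close> is
    \<open>indep_sets\<close> over \<open>bool\<close>, with \<open>True\<close> standing for the
    first family.\<close>
  let ?I = "\<lambda>c. if c then {0::nat} else {1, 2, 3}"
  have "indep_sets (\<lambda>c. sigma_sets (space M) (\<Union>i\<in>?I c. ?F i)) (UNIV :: bool set)"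
  proof (rule indep_sets_collect_sigma)
    have "(\<Union>c. ?I c) = {..<4}" by (auto simp: four split: if_splits)
    then show "indep_sets ?F (\<Union>c. ?I c)" using \<open>indep_sets ?F {..<4}\<close> by simp
  qed (use stable in \<open>auto simp: disjoint_family_on_def numeral_2_eq_2 numeral_3_eq_3 split: if_splits\<close>)
  then show ?thesis
    unfolding indep_set_def
    by (rule indep_sets_mono_sets) (auto simp: Un_assoc numeral_2_eq_2 numeral_3_eq_3 split: bool.split)
qed

text \<open>Once \<open>Y\<close> is fixed at \<open>y\<close>, the event forces \<open>X\<close>
  into a half-open interval of length \<open>e\<close>, which has mass at most \<open>C * e\<close>
  by the density bound. Independence turns the joint law into a product, and integrating over
  \<open>y\<close> keeps the bound.\<close>

lemma prob_sum_bounded_density_le: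
  fixes X Y :: "'a \<Rightarrow> real"
  assumes ind: "indep_var borel X borel Y"
    and X: "distributed M lborel X f"
    and f: "\<And>x. f x \<le> ennreal C" and C: "0 \<le> C" and e: "0 \<le> e"
  shows "prob {\<omega>\<in>space M. -e < X \<omega> + Y \<omega> \<and> X \<omega> + Y \<omega> \<le> 0} \<le> C * e"
proof -
  have [measurable]: "X \<in> borel_measurable M" "Y \<in> borel_measurable M"
    using ind by (auto simp: indep_var_distribution_eq)
  interpret X: prob_space "distr M borel X" by (rule prob_space_distr) simp
  interpret Y: prob_space "distr M borel Y" by (rule prob_space_distr) simp
  interpret P: pair_sigma_finite "distr M borel X" "distr M borel Y" ..
  let ?S = "{z :: real \<times> real. -e < fst z + snd z \<and> fst z + snd z \<le> 0}"
  have "{z \<in> space (borel \<Otimes>\<^sub>M borel). -e < fst z + snd z \<and> fst z + snd z \<le> 0}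
      \<in> sets (borel \<Otimes>\<^sub>M (borel :: real measure))"
    by measurable
  then have [measurable]: "?S \<in> sets (borel \<Otimes>\<^sub>M borel)"
    by (simp add: space_pair_measure)
  have slice: "emeasure (distr M borel X) ((\<lambda>x. (x, y)) -` ?S) \<le> ennreal (C * e)" for y
  proof -
    have "(\<lambda>x. (x, y)) -` ?S = {-e-y<..-y}" by auto
    then have "emeasure (distr M borel X) ((\<lambda>x. (x, y)) -` ?S)
        = emeasure M (X -` {-e-y<..-y} \<inter> space M)"
      by (simp add: emeasure_distr)
    also have "\<dots> = (\<integral>\<^sup>+x. f x * indicator {-e-y<..-y} x \<partial>lborel)"
      by (rule distributed_emeasure[OF X]) simp
    also have "\<dots> \<le> (\<integral>\<^sup>+x. ennreal C * indicator {-e-y<..-y} x \<partial>lborel)"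
      by (intro nn_integral_mono mult_right_mono f) simp
    also have "\<dots> = ennreal (C * e)"
      using e C by (simp add: nn_integral_cmult_indicator ennreal_mult)
    finally show ?thesis .
  qed
  have "emeasure M {\<omega>\<in>space M. -e < X \<omega> + Y \<omega> \<and> X \<omega> + Y \<omega> \<le> 0}
      = emeasure (distr M (borel \<Otimes>\<^sub>M borel) (\<lambda>\<omega>. (X \<omega>, Y \<omega>))) ?S"
    by (subst emeasure_distr) (auto intro!: arg_cong[where f="emeasure M"])
  also have "\<dots> = emeasure (distr M borel X \<Otimes>\<^sub>M distr M borel Y) ?S"
    using ind by (simp add: indep_var_distribution_eq)
  also have "\<dots> = (\<integral>\<^sup>+y. emeasure (distr M borel X) ((\<lambda>x. (x, y)) -` ?S) \<partial>distr M borel Y)"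
    by (rule P.emeasure_pair_measure_alt2) simp
  also have "\<dots> \<le> (\<integral>\<^sup>+y. ennreal (C * e) \<partial>distr M borel Y)"
    by (intro nn_integral_mono slice)
  also have "\<dots> = ennreal (C * e)" using Y.emeasure_space_1 by simp
  finally show ?thesis using C e by (simp add: emeasure_eq_measure)
qed

end

lemma normal_density_le:
  assumes "0 < \<sigma>"
  shows "normal_density \<mu> \<sigma> x \<le> 1 / sqrt (2 * pi * \<sigma>\<^sup>2)"
proof -
  have "exp (- (x - \<mu>)\<^sup>2 / (2 * \<sigma>\<^sup>2)) \<le> 1" by simp
  then have "1 / sqrt (2 * pi * \<sigma>\<^sup>2) * exp (- (x - \<mu>)\<^sup>2 / (2 * \<sigma>\<^sup>2)) \<le> 1 / sqrt (2 * pi * \<sigma>\<^sup>2) * 1"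
    by (intro mult_left_mono) auto
  then show ?thesis by (simp add: normal_density_def)
qed

section \<open>Partitions, polygonal interpolation and uniform convergence\<close>

lemma is_partition_less:
  assumes "is_partition t n p" "i < j" "j \<le> n"
  shows "p i < p j"
  using assms(2,3)
proof (induction j)
  case (Suc j)
  then have "p j < p (Suc j)" using assms(1) by (auto simp: is_partition_def)
  with Suc show ?case by (cases "i = j") auto
qed simp

lemma is_partition_Union:
  assumes p: "is_partition t n p" "n \<ge> 1"
  shows "{0..t} = (\<Union>i\<in>{..<n}. {p i..p (Suc i)})"
proof (intro equalityI subsetI)
  fix x assume x: "x \<in> {0..t}"
  \<comment> \<open>This is the segment index chosen in \<open>piecewise_linear\<close>; the
    restriction \<open>i < n\<close> sends \<open>x = t\<close> to the last segment.\<close>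
  define i where "i = Max {i. i < n \<and> p i \<le> x}"
  have "{i. i < n \<and> p i \<le> x} \<noteq> {}" using p x by (auto simp: is_partition_def intro!: exI[of _ 0])
  then have i: "i \<in> {i. i < n \<and> p i \<le> x}" unfolding i_def by (intro Max_in) auto
  have "x \<le> p (Suc i)"
  proof (cases "Suc i < n")
    case True
    then have "\<not> p (Suc i) \<le> x"
      using Max_ge[of "{i. i < n \<and> p i \<le> x}" "Suc i"] unfolding i_def[symmetric] by auto
    then show ?thesis by simp
  next
    case False
    then have "Suc i = n" using i by auto
    then show ?thesis using p x by (auto simp: is_partition_def)
  qed
  then show "x \<in> (\<Union>i\<in>{..<n}. {p i..p (Suc i)})" using i by auto
next
  fix x assume "x \<in> (\<Union>i\<in>{..<n}. {p i..p (Suc i)})"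
  then obtain i where i: "i < n" "p i \<le> x" "x \<le> p (Suc i)" by auto
  have "p 0 \<le> p i" "p (Suc i) \<le> p n"
    using is_partition_less[OF p(1), of 0 i] is_partition_less[OF p(1), of "Suc i" n] i(1)
    by (cases "i = 0"; cases "Suc i = n"; force)+
  then show "x \<in> {0..t}" using i p by (auto simp: is_partition_def)
qed

text \<open>On each closed segment the function is affine, right endpoint included, so neighbouring
  pieces agree at the shared node and finitely many closed pieces glue to a continuous
  function.\<close>

lemma continuous_on_piecewise_linear:
  assumes p: "is_partition t n p" "n \<ge> 1"
  shows "continuous_on {0..t} (piecewise_linear n p f)"
  unfolding is_partition_Union[OF p]
proof (rule continuous_on_closed_Union)
  fix i assume i: "i \<in> {..<n}"
  have "continuous_on {p i..p (Suc i)}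
      (\<lambda>x. f (p i) + (f (p (Suc i)) - f (p i)) / (p (Suc i) - p i) * (x - p i))"
    by (intro continuous_intros)
  then show "continuous_on {p i..p (Suc i)} (piecewise_linear n p f)"
    by (rule continuous_on_eq) (use i in \<open>simp add: piecewise_linear_on_segment[OF p(1)]\<close>)
qed auto

lemma piecewise_linear_0:
  assumes "is_partition t n p" "n \<ge> 1"
  shows "piecewise_linear n p f 0 = f 0"
proof -
  have "p 0 = 0" using assms(1) by (simp add: is_partition_def)
  moreover have "p 0 < p (Suc 0)" using is_partition_less[OF assms(1), of 0 "Suc 0"] assms(2) by simp
  ultimately have "piecewise_linear n p f 0
      = f (p 0) + (f (p (Suc 0)) - f (p 0)) / (p (Suc 0) - p 0) * (0 - p 0)"
    using assms(2) by (intro piecewise_linear_on_segment[OF assms(1)]) auto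
  then show ?thesis using \<open>p 0 = 0\<close> by simp
qed

text \<open>The supremum is an extended real and may be infinite for small \<open>n\<close>; as soon
  as it drops below \<open>e\<close>, it bounds all pointwise distances at once.\<close>

lemma uniform_limit_of_SUP_tendsto_0:
  fixes f :: "nat \<Rightarrow> real \<Rightarrow> real"
  assumes "(\<lambda>n. SUP s\<in>S. ereal \<bar>f n s - g s\<bar>) \<longlonglongrightarrow> 0"
  shows "uniform_limit S f g sequentially"
proof (rule uniform_limitI)
  fix e :: real assume "0 < e"
  then have "\<forall>\<^sub>F n in sequentially. (SUP s\<in>S. ereal \<bar>f n s - g s\<bar>) < ereal e"
    by (intro order_tendstoD(2)[OF assms]) simp
  then show "\<forall>\<^sub>F n in sequentially. \<forall>s\<in>S. dist (f n s) (g s) < e"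
  proof eventually_elim
    case (elim n)
    show ?case
    proof
      fix s assume "s \<in> S"
      then have "ereal \<bar>f n s - g s\<bar> \<le> (SUP s\<in>S. ereal \<bar>f n s - g s\<bar>)" by (rule SUP_upper)
      then have "ereal \<bar>f n s - g s\<bar> < ereal e" using elim by (rule le_less_trans)
      then show "dist (f n s) (g s) < e" by (simp add: dist_real_def)
    qed
  qed
qed

section \<open>Equidistant grids and suprema of right-continuous functions\<close>

text \<open>Only the indices \<open>j < k\<close> serve as sample points: they start at
  \<open>a\<close> and stop one step short of \<open>t\<close>. Grids for different \<open>k\<close>
  are in general not nested.\<close>

definition grid :: "real \<Rightarrow> real \<Rightarrow> nat \<Rightarrow> nat \<Rightarrow> real" where
  "grid a t k j = a + real j * (t - a) / real k"

lemma grid_in: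
  assumes "a < t" "j < k"
  shows "grid a t k j \<in> {a..<t}"
proof -
  have "real j * (t - a) / real k < t - a"
    using assms by (simp add: divide_simps)
  then show ?thesis using assms by (auto simp: grid_def)
qed

lemma grid_strict_mono:
  assumes "a < t" "0 < k" "i < j"
  shows "grid a t k i < grid a t k j"
  using assms by (simp add: grid_def divide_strict_right_mono)

text \<open>Once the mesh \<open>(t - a) / k\<close> is smaller than \<open>v - u\<close>, the first
  grid point not below \<open>u\<close> cannot jump over \<open>[u, v)\<close>.\<close>

lemma eventually_grid_point_in:
  assumes "a \<le> u" "u < v" "v \<le> t"
  shows "\<forall>\<^sub>F k in sequentially. \<exists>j<k. grid a t k j \<in> {u..<v}"
proof -
  have "\<forall>\<^sub>F k in sequentially. real k > (t - a) / (v - u)"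
    using filterlim_real_sequentially unfolding filterlim_at_top_dense by blast
  then show ?thesis
  proof eventually_elim
    case (elim k)
    have at: "a < t" using assms by simp
    have "0 < (t - a) / (v - u)" using assms at by simp
    then have k: "0 < real k" using elim by linarith
    \<comment> \<open>The real index at which the grid formula would give exactly \<open>u\<close>;
      rounding it up overshoots \<open>u\<close> by less than one mesh width.\<close>
    define x where "x = (u - a) * real k / (t - a)"
    define j where "j = nat \<lceil>x\<rceil>"
    have "0 \<le> x" using assms at k by (simp add: x_def)
    then have j: "x \<le> real j" "real j < x + 1" unfolding j_def by linarith+
    have step: "(t - a) / real k < v - u"
      using elim assms k by (simp add: field_simps)
    have "x * (t - a) / real k = u - a" using k at by (simp add: x_def)
    moreover have "x * (t - a) / real k \<le> real j * (t - a) / real k"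
      using j(1) at k by (intro divide_right_mono mult_right_mono) auto
    moreover have "real j * (t - a) / real k < (x + 1) * (t - a) / real k"
      using j(2) at k by (intro divide_strict_right_mono mult_strict_right_mono) auto
    moreover have "(x + 1) * (t - a) / real k = x * (t - a) / real k + (t - a) / real k"
      by (simp add: distrib_right add_divide_distrib)
    ultimately have g: "u \<le> grid a t k j" "grid a t k j < v"
      using step unfolding grid_def by linarith+
    then have "real j * (t - a) / real k < 1 * (t - a)" using assms by (simp add: grid_def)
    then have "j < k" using at k by (simp add: divide_simps)
    then show ?case using g by auto
  qed
qed

text \<open>By right-continuity the value stays above \<open>c\<close> on some interval
  \<open>[s, v)\<close>, and every sufficiently fine grid meets that interval.\<close>

lemma eventually_grid_value_gt:
  fixes f :: "real \<Rightarrow> real"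
  assumes s: "s \<in> {a..<t}" and f: "(f \<longlongrightarrow> f s) (at_right s)" and c: "c < f s"
  shows "\<forall>\<^sub>F k in sequentially. \<exists>j<k. c < f (grid a t k j)"
proof -
  have "\<forall>\<^sub>F u in at_right s. c < f u" using f c by (rule order_tendstoD)
  then obtain v where v: "s < v" "\<And>u. s < u \<Longrightarrow> u < v \<Longrightarrow> c < f u"
    unfolding eventually_at_right_field by auto
  have "\<forall>\<^sub>F k in sequentially. \<exists>j<k. grid a t k j \<in> {s..<min v t}"
    using s v by (intro eventually_grid_point_in) auto
  then show ?thesis
  proof eventually_elim
    case (elim k)
    then obtain j where "j < k" "s \<le> grid a t k j" "grid a t k j < v" by auto
    then show ?case using v(2)[of "grid a t k j"] c by (cases "grid a t k j = s") auto
  qed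
qed

text \<open>This reduces an uncountable supremum to a countable one, which is what makes it
  measurable. The empty grid \<open>k = 0\<close> contributes minus infinity and is
  harmless.\<close>

lemma SUP_eq_SUP_grid:
  fixes f :: "real \<Rightarrow> real"
  assumes at: "a < t" and f: "\<And>s. s \<in> {a..<t} \<Longrightarrow> (f \<longlongrightarrow> f s) (at_right s)"
  shows "(SUP s\<in>{a..<t}. ereal (f s)) = (SUP k. SUP j\<in>{..<k}. ereal (f (grid a t k j)))"
proof (rule antisym)
  show "(SUP s\<in>{a..<t}. ereal (f s)) \<le> (SUP k. SUP j\<in>{..<k}. ereal (f (grid a t k j)))"
  \<comment> \<open>The bound is proved for every \<open>c\<close> strictly below the value at
    \<open>s\<close>, since a grid only comes close to that value.\<close>
  proof (rule SUP_least, rule dense_le)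
    fix s c assume s: "s \<in> {a..<t}" and c: "c < ereal (f s)"
    show "c \<le> (SUP k. SUP j\<in>{..<k}. ereal (f (grid a t k j)))"
    proof (cases c)
      case (real r)
      then have "\<forall>\<^sub>F k in sequentially. \<exists>j<k. r < f (grid a t k j)"
        using c f[OF s] by (intro eventually_grid_value_gt[OF s]) auto
      then obtain k j where "j < k" "r < f (grid a t k j)"
        by (auto simp: eventually_sequentially)
      then show ?thesis
        unfolding real by (intro SUP_upper2[of k] SUP_upper2[of j]) auto
    qed (use c in auto)
  qed
  show "(SUP k. SUP j\<in>{..<k}. ereal (f (grid a t k j))) \<le> (SUP s\<in>{a..<t}. ereal (f s))"
    by (intro SUP_least SUP_upper grid_in[OF at]) auto
qed

section \<open>Generated sigma-algebras, measurability and right-continuity of paths\<close>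

lemma generated_events_sigma_algebra: "sigma_algebra (space M) (generated_events M I S Y)"
  unfolding generated_events_def by (rule sigma_algebra_sigma_sets) blast

lemma generated_events_subset: "generated_events M I S Y \<subseteq> Pow (space M)"
proof -
  interpret sigma_algebra "space M" "generated_events M I S Y"
    by (rule generated_events_sigma_algebra)
  show ?thesis by (rule space_closed)
qed

lemma vimage_in_generated_events:
  "i \<in> I \<Longrightarrow> A \<in> sets S \<Longrightarrow> Y i -` A \<inter> space M \<in> generated_events M I S Y"
  unfolding generated_events_def by (rule sigma_sets.Basic) blast

text \<open>Here \<open>G\<close> may be a mere generator; below it is a union of sigma-algebras,
  and each variable has its preimages in one of them.\<close>

lemma measurable_sigmaI:
  assumes "\<And>A. A \<in> sets T \<Longrightarrow> Y -` A \<inter> \<Omega> \<in> G" "Y \<in> \<Omega> \<rightarrow> space T" "G \<subseteq> Pow \<Omega>"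
  shows "Y \<in> measurable (sigma \<Omega> G) T"
  using assms by (intro measurableI) (simp_all add: Pi_iff)

lemma measurable_generated_events:
  assumes "i \<in> I" "space S = UNIV"
  shows "Y i \<in> measurable (sigma (space M) (generated_events M I S Y)) S"
proof (rule measurable_sigmaI[OF _ _ generated_events_subset])
  show "Y i -` A \<inter> space M \<in> generated_events M I S Y" if "A \<in> sets S" for A
    using assms(1) that by (rule vimage_in_generated_events)
qed (simp add: assms(2))

text \<open>The random number of summands takes countably many values, and for each fixed value the
  sum is measurable.\<close>

lemma borel_measurable_jump_sum:
  fixes \<eta> :: "nat \<Rightarrow> 'a \<Rightarrow> real"
  assumes n: "n \<in> measurable M (count_space UNIV)" and \<eta>: "\<And>i. i \<ge> 1 \<Longrightarrow> \<eta> i \<in> borel_measurable M"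
  shows "(\<lambda>\<omega>. \<Sum>i=1..n \<omega>. \<eta> i \<omega>) \<in> borel_measurable M"
proof -
  have "(\<lambda>\<omega>. \<Sum>i=1..m. \<eta> i \<omega>) \<in> borel_measurable M" for m :: nat
    by (rule borel_measurable_sum, rule \<eta>) auto
  from measurable_compose_countable[OF this n] show ?thesis .
qed

text \<open>Convergence of \<open>N\<close> in a discrete space means that it is constant just to
  the right of \<open>s\<close>, hence so is the jump sum; the other terms are continuous.\<close>

lemma brownian_with_jumps_tendsto_at_right:
  assumes BM: "standard_brownian_motion M B" and N: "jump_counting_process M N"
    and c: "continuous_on {0..t} c" and \<omega>: "\<omega> \<in> space M" and s: "s \<in> {0..<t}"
  shows "((\<lambda>u. brownian_with_jumps B N \<eta> u \<omega> - c u) \<longlongrightarrow> brownian_with_jumps B N \<eta> s \<omega> - c s) (at_right s)"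
proof -
  have st: "s < t" "0 \<le> s" using s by auto
  have right: "(g \<longlongrightarrow> g s) (at_right s)" if "continuous_on {s..t} g" for g :: "real \<Rightarrow> real"
    using that st at_within_Icc_at_right[OF st(1)] by (auto simp: continuous_on_def dest!: bspec[of _ _ s])
  have "continuous_on {0..} (\<lambda>s. B s \<omega>)" using BM \<omega> by (simp add: standard_brownian_motion_def)
  then have "((\<lambda>u. B u \<omega>) \<longlongrightarrow> B s \<omega>) (at_right s)"
    using st by (intro right) (auto elim: continuous_on_subset)
  moreover have "(c \<longlongrightarrow> c s) (at_right s)"
    using c st by (intro right) (auto elim: continuous_on_subset)
  moreover have "((\<lambda>u. N u \<omega>) \<longlongrightarrow> N s \<omega>) (at_right s)"
    using N \<omega> st by (simp add: jump_counting_process_def)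
  then have "\<forall>\<^sub>F u in at_right s. N u \<omega> = N s \<omega>" by (simp add: tendsto_discrete)
  then have "\<forall>\<^sub>F u in at_right s. (\<Sum>i=1..N u \<omega>. \<eta> i \<omega>) = (\<Sum>i=1..N s \<omega>. \<eta> i \<omega>)"
    by eventually_elim simp
  then have "((\<lambda>u. \<Sum>i=1..N u \<omega>. \<eta> i \<omega>) \<longlongrightarrow> (\<Sum>i=1..N s \<omega>. \<eta> i \<omega>)) (at_right s)"
    by (rule tendsto_eventually)
  ultimately show ?thesis
    unfolding brownian_with_jumps_def by (intro tendsto_intros)
qed

lemma borel_measurable_brownian_with_jumps:
  assumes BM: "standard_brownian_motion M B" and N: "jump_counting_process M N"
    and \<eta>: "\<And>i. i \<ge> 1 \<Longrightarrow> \<eta> i \<in> borel_measurable M" and "0 \<le> s"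
  shows "brownian_with_jumps B N \<eta> s \<in> borel_measurable M"
proof -
  have "B s \<in> borel_measurable M" using BM \<open>0 \<le> s\<close> by (simp add: standard_brownian_motion_def)
  moreover have "N s \<in> measurable M (count_space UNIV)"
    using N \<open>0 \<le> s\<close> by (simp add: jump_counting_process_def)
  ultimately show ?thesis
    unfolding brownian_with_jumps_def
    by (intro borel_measurable_add borel_measurable_jump_sum \<eta>)
qed

lemma borel_measurable_SUP_brownian_with_jumps:
  assumes BM: "standard_brownian_motion M B" and N: "jump_counting_process M N"
    and \<eta>: "\<And>i. i \<ge> 1 \<Longrightarrow> \<eta> i \<in> borel_measurable M"
    and c: "continuous_on {0..t} c" and a: "0 \<le> a" "a < t"
  shows "(\<lambda>\<omega>. SUP s\<in>{a..<t}. ereal (brownian_with_jumps B N \<eta> s \<omega> - c s)) \<in> borel_measurable M"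
proof -
  let ?X = "brownian_with_jumps B N \<eta>"
  have "(\<lambda>\<omega>. SUP k. SUP j\<in>{..<k}. ereal (?X (grid a t k j) \<omega> - c (grid a t k j)))
      \<in> borel_measurable M"
  proof (intro borel_measurable_SUP)
    fix k j :: nat assume "j \<in> {..<k}"
    then have "0 \<le> grid a t k j" using grid_in[OF a(2), of j k] a by auto
    then have "?X (grid a t k j) \<in> borel_measurable M"
      by (intro borel_measurable_brownian_with_jumps[OF BM N] \<eta>)
    then show "(\<lambda>\<omega>. ereal (?X (grid a t k j) \<omega> - c (grid a t k j))) \<in> borel_measurable M"
      by (intro borel_measurable_ereal borel_measurable_diff borel_measurable_const)
  qed auto
  also have "?this \<longleftrightarrow> ?thesis"
    using a by (intro measurable_cong SUP_eq_SUP_grid[symmetric]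
        brownian_with_jumps_tendsto_at_right[OF BM N c]) auto
  finally show ?thesis .
qed

section \<open>The limiting supremum almost surely differs from zero\<close>

context prob_space
begin

text \<open>After subtracting \<open>B a\<close>, the Brownian part at each grid point is a sum of
  increments after time \<open>a\<close>. The maximum is therefore measurable with respect to later
  increments, jump counts and jump sizes, all jointly independent of the first increment.\<close>

lemma indep_var_initial_increment_grid_Max:
  assumes BM: "standard_brownian_motion M B" and N: "jump_counting_process M N"
    and \<eta>: "\<And>i. i \<ge> 1 \<Longrightarrow> \<eta> i \<in> borel_measurable M"
    and ind: "mutually_independent M B N \<eta>"
    and a: "0 < a" "a < t" and k: "0 < k"
  shows "indep_var borel (\<lambda>\<omega>. B a \<omega> - B 0 \<omega>) borel
    (\<lambda>\<omega>. Max ((\<lambda>j. brownian_with_jumps B N \<eta> (grid a t k j) \<omega> - B a \<omega> - c (grid a t k j)) ` {..<k}))"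
    (is "indep_var _ ?Z _ ?W")
proof -
  let ?X = "brownian_with_jumps B N \<eta>"
  define G1 where "G1 = generated_events M {0..} borel B"
  define G2 where "G2 = generated_events M {0..} (count_space UNIV) N"
  define G3 where "G3 = generated_events M {1..} borel \<eta>"
  have alg: "sigma_algebra (space M) G1" "sigma_algebra (space M) G2" "sigma_algebra (space M) G3"
    by (simp_all add: G1_def G2_def G3_def generated_events_sigma_algebra)
  interpret G1: sigma_algebra "space M" G1 by fact
  interpret G2: sigma_algebra "space M" G2 by fact
  interpret G3: sigma_algebra "space M" G3 by fact
  have grid0: "0 \<le> grid a t k j" if "j < k" for j
    using grid_in[OF a(2) that] a by auto
  \<comment> \<open>The time 0 is put in front of the grid, so increment 0 runs from 0 to
    \<open>a\<close> and the increments 1 to \<open>k - 1\<close> connect the \<open>k\<close> grid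
    points.\<close>
  define r where "r j = (case j of 0 \<Rightarrow> 0 | Suc i \<Rightarrow> grid a t k i)" for j
  define Z where "Z i \<omega> = B (r (Suc i)) \<omega> - B (r i) \<omega>" for i \<omega>
  have r1: "r (Suc 0) = a" by (simp add: r_def grid_def)
  have Z0: "Z 0 = ?Z" by (simp add: Z_def r1 fun_eq_iff) (simp add: r_def)
  have rless: "r i < r (Suc i)" for i
    using a k by (cases i) (auto simp: r_def grid_def[of _ _ _ 0] intro: grid_strict_mono)
  have r0: "0 \<le> r i" for i
    using lift_Suc_mono_less[of r 0 i] rless by (cases "i = 0") (auto simp: r_def intro: less_imp_le)
  define E where "E i = {Z i -` A \<inter> space M |A. A \<in> sets borel}" for i
  \<comment> \<open>The generated sigma-algebra is taken instead of the plain union because the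
    splitting lemma asks for closure under intersection.\<close>
  define D where "D = sigma_sets (space M) (\<Union>i\<in>{1..<k}. E i)"
  have "indep_vars (\<lambda>_. borel) Z {..<k}"
    using BM r0 rless unfolding standard_brownian_motion_def Z_def by blast
  then have indE: "indep_sets E {..<k}" by (simp add: indep_vars_def2 E_def[abs_def])
  have Estable: "Int_stable (E i)" for i
    unfolding E_def
  proof (rule Int_stableI, safe)
    fix A A' :: "real set" assume "A \<in> sets borel" "A' \<in> sets borel"
    then show "\<exists>A''. (Z i -` A \<inter> space M) \<inter> (Z i -` A' \<inter> space M) = Z i -` A'' \<inter> space M \<and> A'' \<in> sets borel"
      by (intro exI[of _ "A \<inter> A'"]) auto
  qed
  have Etop: "space M \<in> E i" for i unfolding E_def by (auto intro!: exI[of _ UNIV])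
  have D_alg: "sigma_algebra (space M) D"
    unfolding D_def by (rule sigma_algebra_sigma_sets) (auto simp: E_def)
  interpret D: sigma_algebra "space M" D by fact
  have indED: "indep_set (E 0) D"
  proof -
    let ?I = "\<lambda>c. if c then {0} else {1..<k}"
    have "indep_sets (\<lambda>c. sigma_sets (space M) (\<Union>i\<in>?I c. E i)) (UNIV :: bool set)"
    proof (rule indep_sets_collect_sigma)
      have "(\<Union>c. ?I c) \<subseteq> {..<k}" using k by (auto split: if_splits)
      then show "indep_sets E (\<Union>c. ?I c)" using indE by (rule indep_sets_mono_index)
    qed (auto simp: disjoint_family_on_def Estable split: if_splits)
    then show ?thesis
      unfolding indep_set_def by (rule indep_sets_mono_sets) (auto simp: D_def split: bool.split)
  qed
  have "Z i \<in> measurable (sigma (space M) G1) borel" for i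
    unfolding Z_def G1_def using r0
    by (intro borel_measurable_diff measurable_generated_events) auto
  from measurable_sets[OF this] have EG1: "E i \<subseteq> G1" for i by (auto simp: E_def)
  have DG1: "D \<subseteq> G1" unfolding D_def using EG1 by (intro G1.sigma_sets_subset) auto
  have ind3: "indep_sets (\<lambda>j::nat. [G1, G2, G3] ! j) {..<3}"
    using ind by (simp add: mutually_independent_def G1_def G2_def G3_def)
  have main: "indep_set (sigma_sets (space M) (E 0)) (sigma_sets (space M) (D \<union> G2 \<union> G3))"
  proof (rule indep_set_of_split_component[OF ind3 indED EG1 DG1])
    show "Int_stable D" "Int_stable G2" "Int_stable G3"
      by (auto intro!: Int_stableI)
  qed (fact G1.algebra_axioms Estable Etop D.top G2.top G3.top)+
  let ?H = "D \<union> G2 \<union> G3"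
  have HPow: "?H \<subseteq> Pow (space M)"
    using D.space_closed G2.space_closed G3.space_closed by blast
  have Z_meas: "Z i \<in> measurable (sigma (space M) ?H) borel" if "i \<in> {1..<k}" for i
  proof (rule measurable_sigmaI[OF _ _ HPow])
    fix A :: "real set" assume "A \<in> sets borel"
    then have "Z i -` A \<inter> space M \<in> E i" by (auto simp: E_def)
    then have "Z i -` A \<inter> space M \<in> D"
      unfolding D_def using that by (intro sigma_sets.Basic) blast
    then show "Z i -` A \<inter> space M \<in> ?H" by simp
  qed simp
  have N_meas: "N s \<in> measurable (sigma (space M) ?H) (count_space UNIV)" if "0 \<le> s" for s
  proof (rule measurable_sigmaI[OF _ _ HPow])
    fix A :: "nat set" assume "A \<in> sets (count_space UNIV)"
    then have "N s -` A \<inter> space M \<in> G2"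
      unfolding G2_def using that by (intro vimage_in_generated_events) auto
    then show "N s -` A \<inter> space M \<in> ?H" by simp
  qed simp
  have \<eta>_meas: "\<eta> i \<in> measurable (sigma (space M) ?H) borel" if "i \<ge> 1" for i
  proof (rule measurable_sigmaI[OF _ _ HPow])
    fix A assume "A \<in> sets (borel :: real measure)"
    then have "\<eta> i -` A \<inter> space M \<in> G3"
      unfolding G3_def using that by (intro vimage_in_generated_events) auto
    then show "\<eta> i -` A \<inter> space M \<in> ?H" by simp
  qed simp
  have W: "?W \<in> measurable (sigma (space M) ?H) borel"
  proof (intro borel_measurable_Max)
    fix j assume j: "j \<in> {..<k}"
    \<comment> \<open>Telescoping starts at index 1, so the first increment \<open>Z 0\<close> does
      not enter.\<close>
    have tele: "(\<Sum>i\<in>{1..<Suc j}. Z i \<omega>) = B (grid a t k j) \<omega> - B a \<omega>" for \<omega>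
    proof -
      have "(\<Sum>i\<in>{1..<Suc j}. Z i \<omega>) = B (r (Suc j)) \<omega> - B (r (Suc 0)) \<omega>"
        unfolding Z_def using sum_Suc_diff'[of 1 "Suc j" "\<lambda>i. B (r i) \<omega>"] by simp
      then show ?thesis unfolding r1 by (simp add: r_def)
    qed
    have "(\<lambda>\<omega>. (\<Sum>i\<in>{1..<Suc j}. Z i \<omega>) + (\<Sum>i=1..N (grid a t k j) \<omega>. \<eta> i \<omega>) - c (grid a t k j))
        \<in> measurable (sigma (space M) ?H) borel"
      using j by (intro borel_measurable_diff borel_measurable_add borel_measurable_sum
          borel_measurable_jump_sum Z_meas N_meas \<eta>_meas grid0 borel_measurable_const) auto
    then show "(\<lambda>\<omega>. ?X (grid a t k j) \<omega> - B a \<omega> - c (grid a t k j)) \<in> measurable (sigma (space M) ?H) borel"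
      unfolding tele brownian_with_jumps_def by (simp add: algebra_simps)
  qed simp
  have rvs: "random_variable borel ?Z" "random_variable borel ?W"
  proof -
    have B: "random_variable borel (B s)" if "0 \<le> s" for s
      using BM that by (simp add: standard_brownian_motion_def)
    then show "random_variable borel ?Z" using a by (intro borel_measurable_diff) auto
    show "random_variable borel ?W"
      using a by (intro borel_measurable_Max borel_measurable_diff borel_measurable_const B
          borel_measurable_brownian_with_jumps[OF BM N \<eta>] grid0) auto
  qed
  \<comment> \<open>Independence passes to smaller families, so it is enough that the events of the
    maximum lie in the second sigma-algebra of \<open>main\<close>.\<close>
  have "{?W -` A \<inter> space M |A. A \<in> sets borel} \<subseteq> sigma_sets (space M) ?H"
    using measurable_sets[OF W] unfolding space_measure_of[OF HPow] sets_measure_of[OF HPow] by blast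
  then have "sigma_sets (space M) {?W -` A \<inter> space M |A. A \<in> sets borel} \<subseteq> sigma_sets (space M) ?H"
    by (rule sigma_algebra.sigma_sets_subset[OF sigma_algebra_sigma_sets[OF HPow]])
  then have "indep_set (sigma_sets (space M) {?Z -` A \<inter> space M |A. A \<in> sets borel})
      (sigma_sets (space M) {?W -` A \<inter> space M |A. A \<in> sets borel})"
    using main unfolding indep_set_def
    by (elim indep_sets_mono_sets) (auto simp: E_def Z0 split: bool.splits)
  then show ?thesis using rvs by (simp add: indep_var_eq)
qed

text \<open>If the supremum is 0, then for each \<open>e > 0\<close> all sufficiently fine grid
  maxima lie in \<open>(-e, 0]\<close>. Each such grid event has probability at most
  \<open>C * e\<close> uniformly in \<open>k\<close>, so the same bound holds for the supremum
  event, and \<open>e\<close> tends to 0.\<close>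

lemma AE_SUP_brownian_with_jumps_neq_0:
  assumes BM: "standard_brownian_motion M B" and N: "jump_counting_process M N"
    and \<eta>: "\<And>i. i \<ge> 1 \<Longrightarrow> \<eta> i \<in> borel_measurable M"
    and ind: "mutually_independent M B N \<eta>"
    and c: "continuous_on {0..t} c" and a: "0 < a" "a < t"
  shows "AE \<omega> in M. (SUP s\<in>{a..<t}. ereal (brownian_with_jumps B N \<eta> s \<omega> - c s)) \<noteq> 0"
proof -
  let ?X = "brownian_with_jumps B N \<eta>"
  let ?g = "grid a t"
  let ?S = "\<lambda>\<omega>. SUP s\<in>{a..<t}. ereal (?X s \<omega> - c s)"
  define Z where "Z \<omega> = B a \<omega> - B 0 \<omega>" for \<omega>
  define W where "W k \<omega> = Max ((\<lambda>j. ?X (?g k j) \<omega> - B a \<omega> - c (?g k j)) ` {..<k})" for k \<omega>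
  \<comment> \<open>The peak of the normal density of \<open>B a - B 0\<close>; the form
    \<open>a - 0\<close> matches the increment law with starting time 0.\<close>
  define C where "C = 1 / sqrt (2 * pi * (sqrt (a - 0))\<^sup>2)"
  have C: "0 < C" using a by (simp add: C_def)
  have [measurable]: "?S \<in> borel_measurable M"
    using a by (intro borel_measurable_SUP_brownian_with_jumps[OF BM N \<eta> c]) auto
  have le: "prob {\<omega>\<in>space M. ?S \<omega> = 0} \<le> C * e" if e: "0 < e" for e
  proof -
    define Q where "Q k = {\<omega>\<in>space M. -e < Z \<omega> + W k \<omega> \<and> Z \<omega> + W k \<omega> \<le> 0}" for k
    \<comment> \<open>The union of these increasing sets is the limit inferior of the
      \<open>Q k\<close>. Starting at \<open>Suc K\<close> avoids the empty grid, and
      \<open>R K\<close> inherits the bound from \<open>Q (Suc K)\<close>.\<close>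
    define R where "R K = (\<Inter>k\<in>{Suc K..}. Q k)" for K
    have indk: "indep_var borel Z borel (W k)" if "0 < k" for k
      unfolding Z_def W_def by (rule indep_var_initial_increment_grid_Max[OF BM N \<eta> ind a that])
    have [measurable]: "Q k \<in> events" if "0 < k" for k
      using indk[OF that] by (auto simp: Q_def indep_var_distribution_eq)
    have [measurable]: "R K \<in> events" for K
      unfolding R_def by (intro sets.countable_INT') auto
    have "prob (Q k) \<le> C * e" if "0 < k" for k
      unfolding Q_def
    proof (rule prob_sum_bounded_density_le[OF indk[OF that]])
      show "distributed M lborel Z (normal_density 0 (sqrt (a - 0)))"
        using BM a unfolding standard_brownian_motion_def Z_def by blast
      show "ennreal (normal_density 0 (sqrt (a - 0)) x) \<le> ennreal C" for x
        unfolding C_def using a by (intro ennreal_leI normal_density_le) simp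
    qed (use C e in auto)
    then have RC: "prob (R K) \<le> C * e" for K
      by (intro order.trans[OF finite_measure_mono[of "R K" "Q (Suc K)"]]) (auto simp: R_def)
    have "incseq R" by (auto simp: incseq_def R_def)
    have sub: "{\<omega>\<in>space M. ?S \<omega> = 0} \<subseteq> (\<Union>K. R K)"
    proof safe
      fix \<omega> assume \<omega>: "\<omega> \<in> space M" and S0: "?S \<omega> = 0"
      have B0: "B 0 \<omega> = 0" using BM \<omega> by (simp add: standard_brownian_motion_def)
      have upper: "?X s \<omega> - c s \<le> 0" if "s \<in> {a..<t}" for s
        using SUP_upper[OF that, of "\<lambda>s. ereal (?X s \<omega> - c s)"] S0 by (simp add: zero_ereal_def)
      have "ereal (-e) < ?S \<omega>" using S0 e by simp
      then obtain s where s: "s \<in> {a..<t}" "-e < ?X s \<omega> - c s"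
        by (auto simp: less_SUP_iff)
      have "\<forall>\<^sub>F k in sequentially. \<exists>j<k. -e < ?X (?g k j) \<omega> - c (?g k j)"
        using s a \<omega> by (intro eventually_grid_value_gt[of s]
            brownian_with_jumps_tendsto_at_right[OF BM N c]) auto
      then obtain K where K: "\<And>k. K \<le> k \<Longrightarrow> \<exists>j<k. -e < ?X (?g k j) \<omega> - c (?g k j)"
        unfolding eventually_sequentially by blast
      have "\<omega> \<in> Q k" if "Suc K \<le> k" for k
      proof -
        obtain j where j: "j < k" "-e < ?X (?g k j) \<omega> - c (?g k j)" using K[of k] \<open>Suc K \<le> k\<close> by auto
        have "?X (?g k j) \<omega> - B a \<omega> - c (?g k j) \<le> W k \<omega>"
          unfolding W_def using j(1) by (intro Max_ge) auto
        \<comment> \<open>A vanishing supremum makes every grid value nonpositive, which gives the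
          upper end of \<open>(-e, 0]\<close>; the index \<open>j\<close> gives the lower
          end.\<close>
        moreover have "W k \<omega> \<le> - B a \<omega>"
          unfolding W_def using j(1) upper[OF grid_in[OF a(2)]] by (subst Max_le_iff) (auto simp: algebra_simps)
        ultimately show ?thesis using j(2) \<omega> B0 by (simp add: Q_def Z_def)
      qed
      then show "\<omega> \<in> (\<Union>K. R K)" by (auto simp: R_def)
    qed
    have "(\<lambda>K. prob (R K)) \<longlonglongrightarrow> prob (\<Union>K. R K)"
      using \<open>incseq R\<close> by (intro finite_Lim_measure_incseq) auto
    then have "prob (\<Union>K. R K) \<le> C * e"
      by (rule LIMSEQ_le_const2) (use RC in auto)
    moreover have "prob {\<omega>\<in>space M. ?S \<omega> = 0} \<le> prob (\<Union>K. R K)"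
      by (intro finite_measure_mono sub) auto
    ultimately show ?thesis by simp
  qed
  have "prob {\<omega>\<in>space M. ?S \<omega> = 0} \<le> 0"
  proof (rule field_le_epsilon)
    fix e :: real assume "0 < e"
    then show "prob {\<omega>\<in>space M. ?S \<omega> = 0} \<le> 0 + e" using le[of "e / C"] C by simp
  qed
  then have "prob {\<omega>\<in>space M. ?S \<omega> = 0} = 0" by (simp add: antisym)
  then have "AE \<omega> in M. \<omega> \<notin> {\<omega>\<in>space M. ?S \<omega> = 0}"
    by (intro AE_not_in) (auto simp: null_sets_def emeasure_eq_measure)
  then show ?thesis by (auto elim!: AE_mp intro!: AE_I2)
qed

text \<open>How long the path stays negative after time 0 depends on \<open>\<omega>\<close>, so the
  starting time \<open>a\<close> cannot be fixed in advance. It runs through the countable sequence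
  \<open>t / (m + 2)\<close>, and the exceptional null sets are united.\<close>

lemma AE_SUP_from_0_brownian_with_jumps_neq_0:
  assumes BM: "standard_brownian_motion M B" and N: "jump_counting_process M N"
    and \<eta>: "\<And>i. i \<ge> 1 \<Longrightarrow> \<eta> i \<in> borel_measurable M"
    and ind: "mutually_independent M B N \<eta>"
    and c: "continuous_on {0..t} c" and c0: "0 < c 0" and t: "0 < t"
  shows "AE \<omega> in M. (SUP s\<in>{0..<t}. ereal (brownian_with_jumps B N \<eta> s \<omega> - c s)) \<noteq> 0"
proof -
  let ?X = "brownian_with_jumps B N \<eta>"
  let ?d = "\<lambda>m. t / real (Suc (Suc m))"
  have d: "0 < ?d m" "?d m < t" for m
    using t by (simp_all add: divide_simps add_pos_nonneg)
  have "AE \<omega> in M. \<forall>m. (SUP s\<in>{?d m..<t}. ereal (?X s \<omega> - c s)) \<noteq> 0"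
    unfolding AE_all_countable using d
    by (intro allI AE_SUP_brownian_with_jumps_neq_0[OF BM N \<eta> ind c]) auto
  then show ?thesis
  proof (rule AE_mp, intro AE_I2 impI notI)
    fix \<omega> assume \<omega>: "\<omega> \<in> space M"
      and neq: "\<forall>m. (SUP s\<in>{?d m..<t}. ereal (?X s \<omega> - c s)) \<noteq> 0"
      and S0: "(SUP s\<in>{0..<t}. ereal (?X s \<omega> - c s)) = 0"
    have X0: "?X 0 \<omega> = 0"
      using BM N \<omega> by (simp add: standard_brownian_motion_def jump_counting_process_def brownian_with_jumps_def)
    have "((\<lambda>s. ?X s \<omega> - c s) \<longlongrightarrow> ?X 0 \<omega> - c 0) (at_right 0)"
      using t \<omega> by (intro brownian_with_jumps_tendsto_at_right[OF BM N c]) auto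
    \<comment> \<open>The level \<open>- (c 0 / 2)\<close> lies strictly between the limit
      \<open>- c 0\<close> and 0, so the supremum over the initial stretch is bounded away from
      0.\<close>
    then have "\<forall>\<^sub>F s in at_right 0. ?X s \<omega> - c s < - (c 0 / 2)"
      by (rule order_tendstoD) (use X0 c0 in simp)
    then obtain v where v: "0 < v" "\<And>s. 0 < s \<Longrightarrow> s < v \<Longrightarrow> ?X s \<omega> - c s < - (c 0 / 2)"
      unfolding eventually_at_right_field by auto
    obtain m where m: "t / v < real m" using reals_Archimedean2 by blast
    have "?d m < v"
    proof -
      have "t < real m * v" using m v(1) by (simp add: field_simps)
      also have "\<dots> \<le> real (Suc (Suc m)) * v" using v(1) by (intro mult_right_mono) auto
      finally show ?thesis by (simp add: field_simps)
    qed
    let ?T = "SUP s\<in>{?d m..<t}. ereal (?X s \<omega> - c s)"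
    have "?T \<le> (SUP s\<in>{0..<t}. ereal (?X s \<omega> - c s))"
      using d[of m] by (intro SUP_subset_mono) auto
    then have "?T < 0" using S0 neq by (simp add: order.strict_iff_order)
    have "(SUP s\<in>{0..<t}. ereal (?X s \<omega> - c s)) \<le> max ?T (ereal (- (c 0 / 2)))"
    proof (rule SUP_least)
      fix s assume s: "s \<in> {0..<t}"
      show "ereal (?X s \<omega> - c s) \<le> max ?T (ereal (- (c 0 / 2)))"
      proof (cases "s < ?d m")
        case True
        then have "?X s \<omega> - c s \<le> - (c 0 / 2)"
          using v(2)[of s] s \<open>?d m < v\<close> X0 c0 by (cases "s = 0") auto
        then show ?thesis by (simp add: le_max_iff_disj)
      next
        case False
        then have "ereal (?X s \<omega> - c s) \<le> ?T" using s by (intro SUP_upper) auto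
        then show ?thesis by (simp add: le_max_iff_disj)
      qed
    qed
    also have "\<dots> < 0" using \<open>?T < 0\<close> c0 by simp
    finally show False using S0 by simp
  qed
qed

end

section \<open>Stability of the sign of the supremum and passage to the limit\<close>

lemma SUP_brownian_with_jumps_nonneg:
  assumes "standard_brownian_motion M B" "jump_counting_process M N" "\<omega> \<in> space M"
    and "c 0 \<le> 0" "0 < t"
  shows "0 \<le> (SUP s\<in>{0..<t}. ereal (brownian_with_jumps B N \<eta> s \<omega> - c s))"
proof -
  have "brownian_with_jumps B N \<eta> 0 \<omega> = 0"
    using assms by (simp add: standard_brownian_motion_def jump_counting_process_def brownian_with_jumps_def)
  then show ?thesis using assms by (intro SUP_upper2[of 0]) auto
qed

text \<open>A nonzero supremum leaves room for a uniform error: a negative one stays below some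
  \<open>r < 0\<close>, and a positive one has a single point \<open>s\<close> with positive value
  that survives the perturbation.\<close>

lemma eventually_SUP_less_0_iff:
  fixes f :: "nat \<Rightarrow> 'a \<Rightarrow> real"
  assumes lim: "uniform_limit S f h sequentially" and neq: "(SUP s\<in>S. ereal (x s - h s)) \<noteq> 0"
  shows "\<forall>\<^sub>F n in sequentially. (SUP s\<in>S. ereal (x s - f n s)) < 0 \<longleftrightarrow> (SUP s\<in>S. ereal (x s - h s)) < 0"
proof (cases "(SUP s\<in>S. ereal (x s - h s)) < 0")
  case True
  then obtain r where r: "(SUP s\<in>S. ereal (x s - h s)) < ereal r" "r < 0"
    using ereal_dense2[OF True] by auto
  \<comment> \<open>Half of the gap is spent on the error, so the perturbed supremum is still at
    most \<open>r / 2 < 0\<close>; pointwise negativity alone would allow supremum 0.\<close>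
  have "\<forall>\<^sub>F n in sequentially. \<forall>s\<in>S. dist (f n s) (h s) < - r / 2"
    using r(2) by (intro uniform_limitD[OF lim]) simp
  then show ?thesis
  proof eventually_elim
    case (elim n)
    have "(SUP s\<in>S. ereal (x s - f n s)) \<le> ereal (r / 2)"
    proof (rule SUP_least)
      fix s assume s: "s \<in> S"
      have "ereal (x s - h s) < ereal r" using SUP_upper[OF s] r(1) by (rule le_less_trans)
      moreover have "\<bar>f n s - h s\<bar> < - r / 2" using elim s by (simp add: dist_real_def)
      ultimately show "ereal (x s - f n s) \<le> ereal (r / 2)" by (simp add: abs_less_iff)
    qed
    also have "\<dots> < 0" using r(2) by simp
    finally show ?case using True by simp
  qed
next
  case False
  then have "0 < (SUP s\<in>S. ereal (x s - h s))" using neq by simp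
  then obtain s where s: "s \<in> S" "0 < x s - h s"
    by (auto simp: less_SUP_iff)
  have "\<forall>\<^sub>F n in sequentially. dist (f n s) (h s) < x s - h s"
    using uniform_limitD[OF lim s(2)] by eventually_elim (use s(1) in auto)
  then show ?thesis
  proof eventually_elim
    case (elim n)
    then have "0 \<le> x s - f n s" by (simp add: dist_real_def abs_less_iff)
    then have "0 \<le> (SUP s\<in>S. ereal (x s - f n s))" using s(1) by (intro SUP_upper2[of s]) auto
    then show ?case using False by simp
  qed
qed

theorem mainTheorem4:
  fixes M :: "'w measure"
    and B :: "real \<Rightarrow> 'w \<Rightarrow> real"
    and N :: "real \<Rightarrow> 'w \<Rightarrow> nat"
    and \<eta> :: "nat \<Rightarrow> 'w \<Rightarrow> real"
    and t :: real
    and b :: "real \<Rightarrow> real"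
    and p :: "nat \<Rightarrow> nat \<Rightarrow> real"
  assumes "prob_space M"
    and "standard_brownian_motion M B"
    and "jump_counting_process M N"
    and "\<And>i. i \<ge> 1 \<Longrightarrow> \<eta> i \<in> borel_measurable M"
    and "mutually_independent M B N \<eta>"
    and "t > 0"
    and "\<And>n. n \<ge> 1 \<Longrightarrow> is_partition t n (p n)"
    and "(\<lambda>n. SUP s\<in>{0..t}. ereal \<bar>piecewise_linear n (p n) b s - b s\<bar>) \<longlonglongrightarrow> 0"
  shows "(\<lambda>n. measure M {\<omega>\<in>space M.
              (SUP s\<in>{0..<t}. ereal (brownian_with_jumps B N \<eta> s \<omega> - piecewise_linear n (p n) b s)) < 0})
           \<longlonglongrightarrow> measure M {\<omega>\<in>space M.
              (SUP s\<in>{0..<t}. ereal (brownian_with_jumps B N \<eta> s \<omega> - b s)) < 0}"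
proof -
  interpret prob_space M by fact
  note BM = assms(2) and N = assms(3) and \<eta> = assms(4) and ind = assms(5) and t = assms(6)
    and part = assms(7)
  let ?X = "brownian_with_jumps B N \<eta>"
  let ?f = "\<lambda>n. piecewise_linear n (p n) b"
  let ?A = "\<lambda>c. {\<omega>\<in>space M. (SUP s\<in>{0..<t}. ereal (?X s \<omega> - c s)) < 0}"
  have lim: "uniform_limit {0..t} ?f b sequentially"
    using assms(8) by (rule uniform_limit_of_SUP_tendsto_0)
  have fc: "continuous_on {0..t} (?f n)" if "n \<ge> 1" for n
    using part[OF that] that by (rule continuous_on_piecewise_linear)
  have bc: "continuous_on {0..t} b"
    by (rule uniform_limit_theorem[OF _ lim]) (auto simp: eventually_sequentially intro!: exI[of _ 1] fc)
  have f0: "?f n 0 = b 0" if "n \<ge> 1" for n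
    using part[OF that] that by (rule piecewise_linear_0)
  have meas: "?A c \<in> events" if "continuous_on {0..t} c" for c
  proof -
    have [measurable]: "(\<lambda>\<omega>. SUP s\<in>{0..<t}. ereal (?X s \<omega> - c s)) \<in> borel_measurable M"
      using t by (intro borel_measurable_SUP_brownian_with_jumps[OF BM N \<eta> that]) auto
    show ?thesis by measurable
  qed
  \<comment> \<open>Partitions are constrained only for \<open>n \<ge> 1\<close>, so the sequence is
    shifted by one; the shift is undone at the end.\<close>
  have "(\<lambda>n. measure M (?A (?f (Suc n)))) \<longlonglongrightarrow> measure M (?A b)"
  proof (cases "0 < b 0")
    case False
    then have empty: "?A c = {}" if "c 0 = b 0" for c
      using SUP_brownian_with_jumps_nonneg[OF BM N _ _ t, of _ c \<eta>] that by (auto simp: not_less[symmetric])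
    have "?A (?f (Suc n)) = {}" for n by (rule empty) (simp add: f0)
    moreover have "?A b = {}" by (rule empty) simp
    ultimately show ?thesis by (simp only: measure_empty tendsto_const)
  next
    case True
    have neq: "AE \<omega> in M. (SUP s\<in>{0..<t}. ereal (?X s \<omega> - b s)) \<noteq> 0"
      by (rule AE_SUP_from_0_brownian_with_jumps_neq_0[OF BM N \<eta> ind bc True t])
    \<comment> \<open>Off the null event the indicators are eventually constant in \<open>n\<close>,
      and the constant 1 dominates them.\<close>
    have "(\<lambda>n. \<integral>\<omega>. indicator (?A (?f (Suc n))) \<omega> \<partial>M) \<longlonglongrightarrow> (\<integral>\<omega>. indicator (?A b) \<omega> \<partial>M :: real)"
    proof (rule integral_dominated_convergence[where w="\<lambda>_. 1"])
      show "AE \<omega> in M. (\<lambda>n. indicator (?A (?f (Suc n))) \<omega> :: real) \<longlonglongrightarrow> indicator (?A b) \<omega>"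
        using neq AE_space
      proof eventually_elim
        case (elim \<omega>)
        have "uniform_limit {0..<t} ?f b sequentially"
          using lim by (rule uniform_limit_on_subset) auto
        from eventually_SUP_less_0_iff[OF this elim(1)]
        have "\<forall>\<^sub>F n in sequentially. indicator (?A (?f n)) \<omega> = (indicator (?A b) \<omega> :: real)"
          by eventually_elim (simp add: indicator_def)
        then have "(\<lambda>n. indicator (?A (?f n)) \<omega> :: real) \<longlonglongrightarrow> indicator (?A b) \<omega>"
          by (rule tendsto_eventually)
        then show ?case by (rule LIMSEQ_Suc)
      qed
    qed (use meas bc fc in \<open>auto simp: indicator_def\<close>)
    then show ?thesis using meas bc fc by simp
  qed
  then show ?thesis by (rule LIMSEQ_imp_Suc)
qed

end
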